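(* Let $p=2$. For $j\ge0$ let $c_j$ be the coefficient of the monomial $X_{10}$ in the polynomial $P_j$, where $10$ denotes the two-letter binary word. Then $c_j=[x^j]\log(1+x/2)$ for all $j\ge 0$. In particular, $$\sum_{j\ge 0}c_j=\log(3/2).$$
   Context: Here $p=2$. Words over $\{0,1\}$ are written $w=w_{\mu-1}\cdots w_0$ with $w_{\mu-1}$ leftmost. For a nonnegative integer $n$ with binary expansion $n=\sum_{i\ge 0}n_i2^i$ (padded with infinitely many zero digits) and a word $w$ of length $\mu$ containing a nonzero digit, $|n|_w=|\{i\ge 0: n_{i+\mu-1}\cdots n_i=w_{\mu-1}\cdots w_0\}|$. For $j,n\ge 0$, $\vartheta_2(j,n)=|\{t\in\{0,\ldots,n\}:\nu_2\binom nt=j\}|$, where $\nu_2(m)$ is the exponent of $2$ in $m$. $W$ is the set of all binary words $w_{\mu-1}\cdots w_0$ with $\mu\ge 2$, $w_{\mu-1}=1$ and $w_0=0$. For each $j\ge0$, $P_j$ denotes the polynomial in the variables $X_w$ ($w\in W$) such that $\vartheta_2(j,n)/\vartheta_2(0,n)=P_j\bigl((|n|_w)_{w\in W}\bigr)$ for all $n\ge 0$; such a polynomial exists and is unique. $[x^j]f(x)$ denotes the coefficient of $x^j$ in the power series $f$. *)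

theory Defs
  imports
    "HOL-Library.Poly_Mapping"
    "HOL-Computational_Algebra.Computational_Algebra"
begin

text \<open>
  Binary words are lists of Booleans (\<open>True\<close> is the digit 1), written leftmost letter first:
  the list \<open>[w\<^sub>\<mu>\<^sub>-\<^sub>1, \<dots>, w\<^sub>0]\<close> stands for the word \<open>w\<^sub>\<mu>\<^sub>-\<^sub>1 \<dots> w\<^sub>0\<close>, so that \<open>w\<^sub>k = rev w ! k\<close>.
\<close>

type_synonym word = "bool list"

text \<open>
  \<open>|n|\<^sub>w\<close>. The positions \<open>i\<close> range over all natural numbers, as \<open>bit n\<close> is the binary expansion
  padded with infinitely many zeros; the set is finite as soon as \<open>w\<close> contains the digit 1.
\<close>

definition occ :: "nat \<Rightarrow> word \<Rightarrow> nat" where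
  "occ n w = card {i. \<forall>k < length w. bit n (i + k) = rev w ! k}"

definition theta2 :: "nat \<Rightarrow> nat \<Rightarrow> nat" where
  "theta2 j n = card {t \<in> {0..n}. multiplicity 2 (n choose t) = j}"

definition W :: "word set" where
  "W = {w. length w \<ge> 2 \<and> hd w = True \<and> last w = False}"

text \<open>
  Polynomials in commuting variables indexed by words: a monomial is a finitely supported
  exponent function, a polynomial a finitely supported function from monomials to coefficients.
\<close>

type_synonym monomial = "word \<Rightarrow>\<^sub>0 nat"
type_synonym word_poly = "monomial \<Rightarrow>\<^sub>0 real"

definition eval_poly :: "word_poly \<Rightarrow> (word \<Rightarrow> real) \<Rightarrow> real" where
  "eval_poly P x =
     (\<Sum>m\<in>Poly_Mapping.keys P. Poly_Mapping.lookup P m * (\<Prod>w\<in>Poly_Mapping.keys m. x w ^ Poly_Mapping.lookup m w))"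

definition variables :: "word_poly \<Rightarrow> word set" where
  "variables P = (\<Union>m\<in>Poly_Mapping.keys P. Poly_Mapping.keys m)"

text \<open>
  The polynomial \<open>P\<^sub>j\<close>; the ratio has nonzero denominator since \<open>n choose 0 = 1\<close>.
\<close>

definition theta_poly :: "nat \<Rightarrow> word_poly" where
  "theta_poly j = (THE Q. variables Q \<subseteq> W \<and>
     (\<forall>n. real (theta2 j n) / real (theta2 0 n) = eval_poly Q (\<lambda>w. real (occ n w))))"

definition coeff_X10 :: "nat \<Rightarrow> real" where
  "coeff_X10 j = Poly_Mapping.lookup (theta_poly j) (Poly_Mapping.single [True, False] 1)"

text \<open>
  The formal power series \<open>log (1 + x/2)\<close>; note that \<open>fps_ln 1\<close> is the series of \<open>log (1 + x)\<close>.
\<close>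

definition log_series :: "real fps" where
  "log_series = fps_ln 1 oo (fps_const (1/2) * fps_X)"

end

theory Submission
  imports Defs
begin

text \<open>
  Let \<open>T\<^sub>n\<close> be the generating function of the 2-adic valuations of the entries in row \<open>n\<close> of
  Pascal's triangle, so that \<open>P\<^sub>j\<close> represents the coefficients of \<open>T\<^sub>n / T\<^sub>n(0)\<close>. Appending a digit
  to \<open>n\<close> acts on \<open>T\<^sub>n\<close> and a companion series by a 2 by 2 matrix of determinant \<open>2X\<close>. Hence the
  logarithmic derivative \<open>D\<^sub>n = T\<^sub>n' / T\<^sub>n\<close> telescopes into a sum over the words of \<open>W\<close> of \<open>|n|\<^sub>w\<close>
  times a fixed series \<open>\<delta>\<^sub>w\<close> of order at least \<open>|w| - 2\<close>, and each coefficient of \<open>D\<^sub>n\<close> is a linear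
  form in finitely many of the \<open>|n|\<^sub>w\<close>. Solving \<open>F' = D F\<close> coefficientwise with these linear
  forms produces \<open>P\<^sub>j\<close>; as \<open>F\<close> is the exponential of the integral of \<open>D\<close>, the linear coefficient
  of \<open>X\<^sub>w\<close> is a coefficient of the integral of \<open>\<delta>\<^sub>w\<close>. For \<open>w = 10\<close> this is \<open>log (T\<^sub>2 / 2) = log (1 + x/2)\<close>.

  Uniqueness of \<open>P\<^sub>j\<close> holds since the vectors \<open>(|n|\<^sub>w)\<^sub>w\<close>, restricted to short words, are
  Zariski dense: they may be translated by the contribution of any isolated block of digits, and
  combinations of these contributions give all unit vectors.
\<close>

subsection \<open>Polynomials over words\<close>

definition eval_monomial :: "monomial \<Rightarrow> (word \<Rightarrow> real) \<Rightarrow> real" where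
  "eval_monomial m x = (\<Prod>w\<in>Poly_Mapping.keys m. x w ^ Poly_Mapping.lookup m w)"

lemma eval_poly_altdef:
  "eval_poly P x = (\<Sum>m\<in>Poly_Mapping.keys P. Poly_Mapping.lookup P m * eval_monomial m x)"
  by (simp add: eval_poly_def eval_monomial_def)

lemma eval_monomial_superset:
  assumes "finite S" "Poly_Mapping.keys m \<subseteq> S"
  shows "eval_monomial m x = (\<Prod>w\<in>S. x w ^ Poly_Mapping.lookup m w)"
  unfolding eval_monomial_def using assms
  by (intro prod.mono_neutral_left) (auto simp: in_keys_iff)

lemma eval_monomial_zero [simp]: "eval_monomial 0 x = 1"
  by (simp add: eval_monomial_def)

lemma eval_monomial_single [simp]: "eval_monomial (Poly_Mapping.single w k) x = x w ^ k"
  by (simp add: eval_monomial_def)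

lemma eval_monomial_add: "eval_monomial (m + m') x = eval_monomial m x * eval_monomial m' x"
proof -
  define S where "S = Poly_Mapping.keys m \<union> Poly_Mapping.keys m'"
  have S: "finite S" "Poly_Mapping.keys m \<subseteq> S" "Poly_Mapping.keys m' \<subseteq> S"
    "Poly_Mapping.keys (m + m') \<subseteq> S"
    using keys_add[of m m'] by (auto simp: S_def)
  then show ?thesis
    by (simp add: eval_monomial_superset[of S] lookup_add power_add prod.distrib)
qed

lemma eval_poly_superset:
  assumes "finite S" "Poly_Mapping.keys P \<subseteq> S"
  shows "eval_poly P x = (\<Sum>m\<in>S. Poly_Mapping.lookup P m * eval_monomial m x)"
  unfolding eval_poly_altdef using assms
  by (intro sum.mono_neutral_left) (auto simp: in_keys_iff)

lemma eval_poly_zero [simp]: "eval_poly 0 x = 0"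
  by (simp add: eval_poly_altdef)

lemma eval_poly_single [simp]: "eval_poly (Poly_Mapping.single m c) x = c * eval_monomial m x"
  by (simp add: eval_poly_altdef)

lemma eval_poly_one [simp]: "eval_poly 1 x = 1"
  using eval_poly_single[of 0 1 x] by simp

lemma eval_poly_add: "eval_poly (P + Q) x = eval_poly P x + eval_poly Q x"
proof -
  define S where "S = Poly_Mapping.keys P \<union> Poly_Mapping.keys Q"
  have S: "finite S" "Poly_Mapping.keys P \<subseteq> S" "Poly_Mapping.keys Q \<subseteq> S"
    "Poly_Mapping.keys (P + Q) \<subseteq> S"
    using keys_add[of P Q] by (auto simp: S_def)
  then show ?thesis
    by (simp add: eval_poly_superset[of S] lookup_add algebra_simps sum.distrib)
qed

lemma eval_poly_uminus: "eval_poly (- P) x = - eval_poly P x"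
  using eval_poly_add[of P "- P" x] by simp

lemma eval_poly_diff: "eval_poly (P - Q) x = eval_poly P x - eval_poly Q x"
  using eval_poly_add[of P "- Q" x] by (simp add: eval_poly_uminus)

lemma eval_poly_sum: "eval_poly (sum f A) x = (\<Sum>a\<in>A. eval_poly (f a) x)"
  by (induction A rule: infinite_finite_induct) (simp_all add: eval_poly_add)

lemma word_poly_eq_sum_single:
  fixes P :: word_poly
  shows "P = (\<Sum>m\<in>Poly_Mapping.keys P. Poly_Mapping.single m (Poly_Mapping.lookup P m))"
proof (rule poly_mapping_eqI)
  fix k
  show "Poly_Mapping.lookup P k =
    Poly_Mapping.lookup (\<Sum>m\<in>Poly_Mapping.keys P. Poly_Mapping.single m (Poly_Mapping.lookup P m)) k"
    by (simp add: lookup_sum lookup_single when_def in_keys_iff)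
qed

lemma eval_poly_mult: "eval_poly (P * Q) x = eval_poly P x * eval_poly Q x"
proof -
  have "eval_poly (P * Q) x =
    eval_poly ((\<Sum>m\<in>Poly_Mapping.keys P. Poly_Mapping.single m (Poly_Mapping.lookup P m)) *
      (\<Sum>m\<in>Poly_Mapping.keys Q. Poly_Mapping.single m (Poly_Mapping.lookup Q m))) x"
    using word_poly_eq_sum_single by metis
  also have "\<dots> = eval_poly P x * eval_poly Q x"
    unfolding eval_poly_altdef[of P] eval_poly_altdef[of Q]
    by (simp add: sum_product mult_single eval_poly_sum eval_monomial_add mult_ac)
  finally show ?thesis .
qed

section \<open>Constant and linear coefficients of products\<close>

lemma lookup_single_mult:
  fixes P :: word_poly
  shows "Poly_Mapping.lookup (Poly_Mapping.single a c * P) b =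
    (\<Sum>m\<in>Poly_Mapping.keys P. if a + m = b then c * Poly_Mapping.lookup P m else 0)"
proof -
  have "Poly_Mapping.single a c * P =
    Poly_Mapping.single a c *
      (\<Sum>m\<in>Poly_Mapping.keys P. Poly_Mapping.single m (Poly_Mapping.lookup P m))"
    using word_poly_eq_sum_single by metis
  also have "\<dots> = (\<Sum>m\<in>Poly_Mapping.keys P. Poly_Mapping.single (a + m) (c * Poly_Mapping.lookup P m))"
    by (simp add: sum_distrib_left mult_single)
  finally show ?thesis
    by (simp add: lookup_sum lookup_single when_def)
qed

lemma single_one_add_eq_single_iff:
  fixes m :: monomial
  shows "Poly_Mapping.single v 1 + m = Poly_Mapping.single w 1 \<longleftrightarrow> v = w \<and> m = 0"
proof
  assume eq: "Poly_Mapping.single v 1 + m = Poly_Mapping.single w 1"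
  have lookup: "(if v = u then 1 else 0) + Poly_Mapping.lookup m u = (if w = u then 1 else 0)" for u
    using arg_cong[OF eq, of "\<lambda>p. Poly_Mapping.lookup p u"]
    by (auto simp: lookup_add lookup_single when_def split: if_splits)
  have "v = w"
    using lookup[of v] by (auto split: if_splits)
  with eq show "v = w \<and> m = 0" by simp
qed simp

lemma single_one_add_neq_zero:
  fixes m :: monomial
  shows "Poly_Mapping.single v 1 + m \<noteq> 0"
proof
  assume "Poly_Mapping.single v 1 + m = 0"
  from arg_cong[OF this, of "\<lambda>p. Poly_Mapping.lookup p v"] show False
    by (simp add: lookup_add lookup_single)
qed

text \<open>A variable factor raises every degree by one, so a linear term of the product can only
  come from the constant term of \<open>P\<close>.\<close>

lemma lookup_variable_mult:
  fixes P :: word_poly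
  shows "Poly_Mapping.lookup (Poly_Mapping.single (Poly_Mapping.single v 1) c * P) (Poly_Mapping.single w 1) =
    (if v = w then c * Poly_Mapping.lookup P 0 else 0)"
  by (auto simp only: lookup_single_mult single_one_add_eq_single_iff sum.delta finite_keys
      in_keys_iff simp_thms if_False if_True sum.neutral_const split: if_splits)

lemma lookup_variable_mult_zero:
  fixes P :: word_poly
  shows "Poly_Mapping.lookup (Poly_Mapping.single (Poly_Mapping.single v 1) c * P) 0 = 0"
  by (simp only: lookup_single_mult single_one_add_neq_zero if_False sum.neutral_const)

lemma variables_zero [simp]: "variables 0 = {}"
  by (simp add: variables_def)

lemma variables_one [simp]: "variables 1 = {}"
  by (simp add: variables_def)

lemma variables_single_subset: "variables (Poly_Mapping.single m c) \<subseteq> Poly_Mapping.keys m"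
  by (simp add: variables_def)

lemma variables_add_subset: "variables (P + Q) \<subseteq> variables P \<union> variables Q"
  using keys_add[of P Q] by (auto simp: variables_def)

lemma variables_diff_subset: "variables (P - Q) \<subseteq> variables P \<union> variables Q"
  using keys_diff[of P Q] by (auto simp: variables_def)

lemma variables_mult_subset: "variables (P * Q) \<subseteq> variables P \<union> variables Q"
proof
  fix w assume "w \<in> variables (P * Q)"
  then obtain m where m: "m \<in> Poly_Mapping.keys (P * Q)" "w \<in> Poly_Mapping.keys m"
    by (auto simp: variables_def)
  then obtain a b where "m = a + b" "a \<in> Poly_Mapping.keys P" "b \<in> Poly_Mapping.keys Q"
    using keys_mult[of P Q] by auto
  with m(2) keys_add[of a b] show "w \<in> variables P \<union> variables Q"
    by (auto simp: variables_def)
qed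

lemma variables_sum_subset: "variables (sum f A) \<subseteq> (\<Union>a\<in>A. variables (f a))"
proof (induction A rule: infinite_finite_induct)
  case (insert a A)
  then show ?case using variables_add_subset[of "f a" "sum f A"] by auto
qed auto

lemma finite_variables [simp]: "finite (variables P)"
  by (simp add: variables_def)

text \<open>
  Dedekind's argument: doubling one variable multiplies the monomials by different powers of 2,
  so a linear relation between distinct monomials can be shortened.
\<close>

lemma monomials_linearly_independent:
  assumes "finite A" "\<And>x. (\<Sum>m\<in>A. c m * eval_monomial m x) = 0" "m \<in> A"
  shows "c m = 0"
  using assms
proof (induction A arbitrary: c m rule: finite_induct)
  case (insert a A)
  have scale: "eval_monomial m (x(w := 2 * x w)) = 2 ^ Poly_Mapping.lookup m w * eval_monomial m x" for m w x
  proof -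
    have "eval_monomial m (x(w := 2 * x w)) =
      (\<Prod>u\<in>insert w (Poly_Mapping.keys m). (x(w := 2 * x w)) u ^ Poly_Mapping.lookup m u)"
      by (rule eval_monomial_superset) auto
    also have "\<dots> = (\<Prod>u\<in>insert w (Poly_Mapping.keys m).
        (if u = w then 2 ^ Poly_Mapping.lookup m w else 1) * x u ^ Poly_Mapping.lookup m u)"
      by (rule prod.cong) (auto simp: power_mult_distrib)
    also have "\<dots> = 2 ^ Poly_Mapping.lookup m w *
        (\<Prod>u\<in>insert w (Poly_Mapping.keys m). x u ^ Poly_Mapping.lookup m u)"
      by (subst prod.distrib, subst prod.delta) auto
    also have "(\<Prod>u\<in>insert w (Poly_Mapping.keys m). x u ^ Poly_Mapping.lookup m u) = eval_monomial m x"
      by (rule eval_monomial_superset[symmetric]) auto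
    finally show ?thesis .
  qed
  have A0: "c m = 0" if "m \<in> A" for m
  proof -
    from that insert.hyps have "m \<noteq> a" by auto
    then obtain w where w: "Poly_Mapping.lookup m w \<noteq> Poly_Mapping.lookup a w"
      by (metis poly_mapping_eqI)
    \<comment> \<open>These coefficients vanish at \<open>a\<close>, so the relation after doubling
      minus \<open>2 ^ lookup a w\<close> times the original one lives on \<open>A\<close> alone;
      the choice of \<open>w\<close> makes the factor nonzero at the given monomial.\<close>
    let ?c = "\<lambda>m. c m * (2 ^ Poly_Mapping.lookup m w - 2 ^ Poly_Mapping.lookup a w)"
    have "(\<Sum>m\<in>A. ?c m * eval_monomial m x) = 0" for x
    proof -
      have "(\<Sum>m\<in>A. ?c m * eval_monomial m x) = (\<Sum>m\<in>insert a A. ?c m * eval_monomial m x)"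
        using insert.hyps by simp
      also have "\<dots> = (\<Sum>m\<in>insert a A. c m * eval_monomial m (x(w := 2 * x w)))
          - 2 ^ Poly_Mapping.lookup a w * (\<Sum>m\<in>insert a A. c m * eval_monomial m x)"
        unfolding scale sum_distrib_left sum_subtractf[symmetric] by (simp add: algebra_simps)
      also have "\<dots> = 0" by (simp only: insert.prems(1))
      finally show ?thesis .
    qed
    from insert.IH[of ?c, OF this \<open>m \<in> A\<close>] w show "c m = 0" by simp
  qed
  \<comment> \<open>At the all-ones point every monomial equals 1.\<close>
  moreover have "c a = 0"
    using insert.prems(1)[of "\<lambda>_. 1"] insert.hyps A0 by (simp add: eval_monomial_def)
  ultimately show ?case using insert.prems(2) by auto
qed auto

lemma eval_poly_eq_zero_imp_zero:
  assumes "\<And>x. eval_poly P x = 0"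
  shows "P = 0"
proof (rule poly_mapping_eqI)
  fix m
  show "Poly_Mapping.lookup P m = Poly_Mapping.lookup 0 m"
    using monomials_linearly_independent[of "Poly_Mapping.keys P" "Poly_Mapping.lookup P" m] assms
    by (cases "m \<in> Poly_Mapping.keys P") (auto simp: eval_poly_altdef in_keys_iff)
qed

subsection \<open>Zariski density\<close>

text \<open>Closure rules instead of a normal form: translation and restriction to a line follow by
  induction.\<close>

inductive polyfun :: "'a set \<Rightarrow> (('a \<Rightarrow> real) \<Rightarrow> real) \<Rightarrow> bool" for V where
  polyfun_const: "polyfun V (\<lambda>_. c)"
| polyfun_coord: "v \<in> V \<Longrightarrow> polyfun V (\<lambda>x. x v)"
| polyfun_add: "polyfun V f \<Longrightarrow> polyfun V g \<Longrightarrow> polyfun V (\<lambda>x. f x + g x)"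
| polyfun_mult: "polyfun V f \<Longrightarrow> polyfun V g \<Longrightarrow> polyfun V (\<lambda>x. f x * g x)"

lemma polyfun_power: "polyfun V f \<Longrightarrow> polyfun V (\<lambda>x. f x ^ k)"
  by (induction k) (auto intro: polyfun.intros)

lemma polyfun_sum: "(\<And>a. a \<in> A \<Longrightarrow> polyfun V (f a)) \<Longrightarrow> polyfun V (\<lambda>x. \<Sum>a\<in>A. f a x)"
  by (induction A rule: infinite_finite_induct) (auto intro: polyfun.intros)

lemma polyfun_prod: "(\<And>a. a \<in> A \<Longrightarrow> polyfun V (f a)) \<Longrightarrow> polyfun V (\<lambda>x. \<Prod>a\<in>A. f a x)"
  by (induction A rule: infinite_finite_induct) (auto intro: polyfun.intros)

lemma polyfun_eval_poly: "variables P \<subseteq> V \<Longrightarrow> polyfun V (eval_poly P)"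
  unfolding eval_poly_def
  by (intro polyfun_sum polyfun_mult polyfun_const polyfun_prod polyfun_power polyfun_coord)
    (auto simp: variables_def)

lemma polyfun_cong:
  assumes "polyfun V f" "\<And>v. v \<in> V \<Longrightarrow> x v = y v"
  shows "f x = f y"
  using assms by induction auto

lemma polyfun_translate: "polyfun V f \<Longrightarrow> polyfun V (\<lambda>x. f (\<lambda>v. x v + d v))"
proof (induction rule: polyfun.induct)
  case (polyfun_coord v)
  then show ?case by (intro polyfun.polyfun_add polyfun.polyfun_const polyfun.polyfun_coord)
qed (auto intro: polyfun.intros)

lemma polyfun_on_line:
  assumes "polyfun V f"
  shows "\<exists>p. \<forall>t. f (\<lambda>v. x v + t * d v) = poly p t"
  using assms
proof induction
  case (polyfun_const c)
  show ?case by (rule exI[of _ "[:c:]"]) simp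
next
  case (polyfun_coord v)
  show ?case by (rule exI[of _ "[:x v, d v:]"]) simp
next
  case (polyfun_add f g)
  then obtain p q where "\<forall>t. f (\<lambda>v. x v + t * d v) = poly p t" "\<forall>t. g (\<lambda>v. x v + t * d v) = poly q t"
    by auto
  then show ?case by (intro exI[of _ "p + q"]) simp
next
  case (polyfun_mult f g)
  then obtain p q where "\<forall>t. f (\<lambda>v. x v + t * d v) = poly p t" "\<forall>t. g (\<lambda>v. x v + t * d v) = poly q t"
    by auto
  then show ?case by (intro exI[of _ "p * q"]) simp
qed

definition zariski_closure :: "'a set \<Rightarrow> ('a \<Rightarrow> real) set \<Rightarrow> ('a \<Rightarrow> real) set" where
  "zariski_closure V S = {x. \<forall>f. polyfun V f \<longrightarrow> (\<forall>s\<in>S. f s = 0) \<longrightarrow> f x = 0}"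

lemma zariski_closure_cong:
  assumes "x \<in> zariski_closure V S" "\<And>v. v \<in> V \<Longrightarrow> x v = y v"
  shows "y \<in> zariski_closure V S"
  unfolding zariski_closure_def
proof (intro CollectI allI impI)
  fix f assume f: "polyfun V f" "\<forall>s\<in>S. f s = 0"
  have "f x = f y" by (rule polyfun_cong[OF f(1) assms(2)])
  moreover have "f x = 0" using assms(1) f by (simp add: zariski_closure_def)
  ultimately show "f y = 0" by simp
qed

text \<open>If \<open>f\<close> vanishes on \<open>S\<close>, so does its translate by
  \<open>d\<close>; hence the closure is stable under this translation. Along the line,
  \<open>f\<close> is a univariate polynomial vanishing at all natural numbers, hence at every real
  \<open>t\<close>, negative ones included.\<close>

lemma zariski_closure_line:
  assumes step: "\<And>s. s \<in> S \<Longrightarrow> \<exists>s'\<in>S. \<forall>v\<in>V. s' v = s v + d v"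
    and x: "x \<in> zariski_closure V S"
  shows "(\<lambda>v. x v + t * d v) \<in> zariski_closure V S"
  unfolding zariski_closure_def
proof (intro CollectI allI impI)
  fix f assume f: "polyfun V f" "\<forall>s\<in>S. f s = 0"
  have translate: "f (\<lambda>v. y v + d v) = 0" if y: "y \<in> zariski_closure V S" and f: "polyfun V f" "\<forall>s\<in>S. f s = 0" for y f
  proof -
    have "f (\<lambda>v. s v + d v) = 0" if s: "s \<in> S" for s
    proof -
      from step[OF s] obtain s' where "s' \<in> S" "\<forall>v\<in>V. s' v = s v + d v" by auto
      with f polyfun_cong[OF f(1), of s' "\<lambda>v. s v + d v"] show ?thesis by auto
    qed
    with y polyfun_translate[OF f(1), of d] show ?thesis
      unfolding zariski_closure_def by auto
  qed
  have nat: "(\<lambda>v. x v + real k * d v) \<in> zariski_closure V S" for k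
  proof (induction k)
    case 0
    show ?case using x by simp
  next
    case (Suc k)
    show ?case
      unfolding zariski_closure_def
      using translate[OF Suc] by (auto simp: algebra_simps)
  qed
  obtain p where p: "\<And>t. f (\<lambda>v. x v + t * d v) = poly p t"
    using polyfun_on_line[OF f(1)] by metis
  have "poly p (real k) = 0" for k
    using nat[of k] f unfolding p[symmetric] by (auto simp: zariski_closure_def)
  then have "range real \<subseteq> {t. poly p t = 0}" by auto
  moreover have "infinite (range real)" by (simp add: finite_image_iff)
  ultimately have "p = 0"
    using poly_roots_finite finite_subset by blast
  then show "f (\<lambda>v. x v + t * d v) = 0" by (simp add: p)
qed

subsection \<open>The generating function of a row of Pascal's triangle\<close>

lemma multiplicity_2_odd: "odd (k :: nat) \<Longrightarrow> multiplicity 2 k = 0"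
  by (simp add: not_dvd_imp_multiplicity_0)

lemma multiplicity_2_mult:
  "a \<noteq> 0 \<Longrightarrow> b \<noteq> 0 \<Longrightarrow> multiplicity 2 (a * b :: nat) = multiplicity 2 a + multiplicity 2 b"
  by (rule prime_elem_multiplicity_mult_distrib) auto

lemma multiplicity_2_double: "a \<noteq> 0 \<Longrightarrow> multiplicity 2 (2 * a :: nat) = Suc (multiplicity 2 a)"
  by (simp add: multiplicity_2_mult)

lemma multiplicity_2_eqI:
  assumes "a * b = c * (d :: nat)" "odd a" "odd c" "b \<noteq> 0"
  shows "multiplicity 2 b = multiplicity 2 d"
proof -
  have nz: "a \<noteq> 0" "c \<noteq> 0" "d \<noteq> 0"
    using assms by (auto intro!: Nat.gr0I)
  have "multiplicity 2 a + multiplicity 2 b = multiplicity 2 c + multiplicity 2 d"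
    using arg_cong[OF assms(1), of "multiplicity 2"] nz assms(4) by (simp add: multiplicity_2_mult)
  then show ?thesis
    using assms(2,3) by (simp add: multiplicity_2_odd)
qed

text \<open>By Kummer's theorem the valuation counts carries, and an appended zero adds none. The
  proof compares absorption identities: those of the doubled row differ by odd factors and by one
  factor 2 on each side.\<close>

lemma multiplicity_2_choose_double:
  "t \<le> n \<Longrightarrow> multiplicity 2 ((2 * n) choose (2 * t)) = multiplicity 2 (n choose t)"
proof (induction t arbitrary: n)
  case (Suc t)
  then obtain m where n: "n = Suc m" "t \<le> m" by (cases n) auto
  have "Suc (2 * t) * ((2 * m + 1) choose (Suc (2 * t))) = (2 * m + 1) * ((2 * m) choose (2 * t))"
    using Suc_times_binomial_eq[of "2 * m" "2 * t"] by (simp add: mult_ac)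
  then have odd: "multiplicity 2 ((2 * m + 1) choose (Suc (2 * t))) = multiplicity 2 ((2 * m) choose (2 * t))"
    by (rule multiplicity_2_eqI) (use n in \<open>auto simp del: binomial_Suc_Suc\<close>)
  have "(2 * Suc t) * ((2 * Suc m) choose (2 * Suc t)) = (2 * Suc m) * ((2 * m + 1) choose (Suc (2 * t)))"
    using Suc_times_binomial_eq[of "2 * m + 1" "Suc (2 * t)"] by (simp add: mult_ac)
  then have "multiplicity 2 ((2 * Suc t) * ((2 * Suc m) choose (2 * Suc t))) =
      multiplicity 2 ((2 * Suc m) * ((2 * m + 1) choose (Suc (2 * t))))"
    by (rule arg_cong)
  moreover have "(2 * Suc m) choose (2 * Suc t) \<noteq> 0" "(2 * m + 1) choose (Suc (2 * t)) \<noteq> 0"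
    "(Suc m choose Suc t) \<noteq> 0" "(m choose t) \<noteq> 0"
    using n by (auto simp del: binomial_Suc_Suc)
  ultimately have 1: "multiplicity 2 (2 * Suc t) + multiplicity 2 ((2 * Suc m) choose (2 * Suc t)) =
      multiplicity 2 (2 * Suc m) + multiplicity 2 ((2 * m) choose (2 * t))"
    using odd by (subst (asm) (1 2) multiplicity_2_mult) auto
  have "multiplicity 2 (Suc t * (Suc m choose Suc t)) = multiplicity 2 (Suc m * (m choose t))"
    using Suc_times_binomial_eq[of m t] by (simp only: mult.commute)
  then have 2: "multiplicity 2 (Suc t) + multiplicity 2 (Suc m choose Suc t) =
      multiplicity 2 (Suc m) + multiplicity 2 (m choose t)"
    using \<open>(Suc m choose Suc t) \<noteq> 0\<close> \<open>(m choose t) \<noteq> 0\<close>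
    by (subst (asm) (1 2) multiplicity_2_mult) auto
  have 3: "multiplicity 2 (2 * Suc t) = Suc (multiplicity 2 (Suc t))"
    "multiplicity 2 (2 * Suc m) = Suc (multiplicity 2 (Suc m))"
    by (rule multiplicity_2_double, simp)+
  show ?case using 1 2 3 Suc.IH[OF n(2)] unfolding n(1) by linarith
qed simp

lemma multiplicity_2_choose_odd_even:
  assumes "t \<le> n"
  shows "multiplicity 2 ((2 * n + 1) choose (2 * t)) = multiplicity 2 (n choose t)"
proof -
  have "(2 * (n - t) + 1) * ((2 * n + 1) choose (2 * t)) = (2 * n + 1) * ((2 * n) choose (2 * t))"
    using binomial_absorb_comp[of "2 * n + 1" "2 * t"] assms
    by (simp add: Suc_diff_le right_diff_distrib')
  then have "multiplicity 2 ((2 * n + 1) choose (2 * t)) = multiplicity 2 ((2 * n) choose (2 * t))"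
    by (rule multiplicity_2_eqI) (use assms in \<open>auto simp del: binomial_Suc_Suc\<close>)
  with assms show ?thesis by (simp add: multiplicity_2_choose_double)
qed

lemma multiplicity_2_choose_odd_odd:
  assumes "t \<le> n"
  shows "multiplicity 2 ((2 * n + 1) choose (2 * t + 1)) = multiplicity 2 (n choose t)"
proof -
  have "(2 * t + 1) * ((2 * n + 1) choose (2 * t + 1)) = (2 * n + 1) * ((2 * n) choose (2 * t))"
    using Suc_times_binomial_eq[of "2 * n" "2 * t"] by (simp add: mult_ac)
  then have "multiplicity 2 ((2 * n + 1) choose (2 * t + 1)) = multiplicity 2 ((2 * n) choose (2 * t))"
    by (rule multiplicity_2_eqI) (use assms in \<open>auto simp del: binomial_Suc_Suc\<close>)
  with assms show ?thesis by (simp add: multiplicity_2_choose_double)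
qed

text \<open>Absorption pulls out the factor \<open>2 * Suc n\<close> and leaves an entry of an odd
  row. The extra valuation is what \<open>borrow_gf\<close> records.\<close>

lemma multiplicity_2_choose_even_odd:
  assumes "t \<le> n"
  shows "multiplicity 2 ((2 * Suc n) choose (2 * t + 1)) =
    Suc (multiplicity 2 (Suc n) + multiplicity 2 (n choose t))"
proof -
  have "(2 * t + 1) * ((2 * Suc n) choose (2 * t + 1)) = 2 * Suc n * ((2 * n + 1) choose (2 * t))"
    using Suc_times_binomial_eq[of "2 * n + 1" "2 * t"] by (simp add: mult_ac)
  then have "multiplicity 2 ((2 * t + 1) * ((2 * Suc n) choose (2 * t + 1))) =
      multiplicity 2 (2 * Suc n * ((2 * n + 1) choose (2 * t)))"
    by (rule arg_cong)
  moreover have "(2 * Suc n) choose (2 * t + 1) \<noteq> 0" "(2 * n + 1) choose (2 * t) \<noteq> 0"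
    using assms by (auto simp del: binomial_Suc_Suc)
  ultimately have "multiplicity 2 (2 * t + 1) + multiplicity 2 ((2 * Suc n) choose (2 * t + 1)) =
      multiplicity 2 (2 * Suc n) + multiplicity 2 (n choose t)"
    using multiplicity_2_choose_odd_even[OF assms] by (subst (asm) (1 2) multiplicity_2_mult) auto
  moreover have "multiplicity 2 (2 * Suc n) = Suc (multiplicity 2 (Suc n))"
    by (rule multiplicity_2_double) simp
  moreover have "multiplicity 2 (2 * t + 1) = 0"
    by (rule multiplicity_2_odd) simp
  ultimately show ?thesis by linarith
qed

section \<open>The row series and its companion under appending a digit\<close>

definition row_gf :: "nat \<Rightarrow> real fps" where
  "row_gf n = (\<Sum>t\<le>n. fps_X ^ multiplicity 2 (n choose t))"

text \<open>
  The companion series: it counts \<open>t < n\<close> by the borrows in the subtraction \<open>n - 1 - t\<close>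
  performed on the digits of \<open>n\<close> with an incoming borrow.
\<close>

definition borrow_gf :: "nat \<Rightarrow> real fps" where
  "borrow_gf n = (if n = 0 then 0 else fps_X ^ multiplicity 2 n * row_gf (n - 1))"

lemma fps_nth_row_gf: "fps_nth (row_gf n) j = real (theta2 j n)"
proof -
  have "fps_nth (row_gf n) j = (\<Sum>t\<le>n. if multiplicity 2 (n choose t) = j then 1 else 0)"
    by (auto simp: row_gf_def fps_sum_nth intro!: sum.cong)
  also have "\<dots> = real (card {t \<in> {..n}. multiplicity 2 (n choose t) = j})"
    by (simp add: sum.If_cases Int_def)
  finally show ?thesis by (simp add: theta2_def atLeast0AtMost)
qed

lemma theta2_0_pos: "theta2 0 n > 0"
proof -
  have "0 \<in> {t \<in> {0..n}. multiplicity 2 (n choose t) = 0}"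
    by simp
  then show ?thesis
    unfolding theta2_def by (subst card_gt_0_iff) auto
qed

lemma row_gf_0: "row_gf 0 = 1"
  by (simp add: row_gf_def)

lemma borrow_gf_0: "borrow_gf 0 = 0"
  by (simp add: borrow_gf_def)

lemma sum_even_odd: "(\<Sum>t\<le>2 * n + 1. f t) = (\<Sum>t\<le>n. f (2 * t) + f (2 * t + 1))"
  for f :: "nat \<Rightarrow> 'a :: comm_monoid_add"
  by (induction n) (simp_all add: add_ac)

lemma row_gf_odd: "row_gf (2 * n + 1) = 2 * row_gf n"
proof -
  have "row_gf (2 * n + 1) = (\<Sum>t\<le>n. 2 * fps_X ^ multiplicity 2 (n choose t))"
    unfolding row_gf_def sum_even_odd
    by (intro sum.cong refl) (simp only: atMost_iff multiplicity_2_choose_odd_even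
        multiplicity_2_choose_odd_odd flip: mult_2)
  then show ?thesis by (simp add: row_gf_def sum_distrib_left)
qed

lemma row_gf_even: "row_gf (2 * n) = row_gf n + fps_X * borrow_gf n"
proof (cases n)
  case 0
  then show ?thesis by (simp add: borrow_gf_0)
next
  case (Suc m)
  let ?f = "\<lambda>t. fps_X ^ multiplicity 2 ((2 * n) choose t) :: real fps"
  have "row_gf (2 * n) = (\<Sum>t\<le>2 * m + 1. ?f t) + ?f (2 * n)"
    by (simp add: row_gf_def Suc)
  also have "(\<Sum>t\<le>2 * m + 1. ?f t) = (\<Sum>t\<le>m. ?f (2 * t)) + (\<Sum>t\<le>m. ?f (2 * t + 1))"
    unfolding sum_even_odd sum.distrib ..
  also have "(\<Sum>t\<le>m. ?f (2 * t)) = (\<Sum>t\<le>m. fps_X ^ multiplicity 2 (n choose t))"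
    using Suc by (intro sum.cong) (simp_all only: atMost_iff multiplicity_2_choose_double)
  also have "(\<Sum>t\<le>m. ?f (2 * t + 1)) = (\<Sum>t\<le>m. fps_X * fps_X ^ multiplicity 2 n * fps_X ^ multiplicity 2 (m choose t))"
    unfolding Suc by (intro sum.cong refl, subst multiplicity_2_choose_even_odd)
      (simp_all add: power_add mult_ac)
  also have "\<dots> = fps_X * borrow_gf n"
    by (simp add: borrow_gf_def row_gf_def Suc sum_distrib_left mult_ac)
  finally show ?thesis
    by (simp add: row_gf_def Suc add_ac)
qed

lemma borrow_gf_odd: "borrow_gf (2 * n + 1) = row_gf n + fps_X * borrow_gf n"
  unfolding row_gf_even[symmetric] by (simp add: borrow_gf_def multiplicity_2_odd)

lemma borrow_gf_even: "borrow_gf (2 * n) = 2 * fps_X * borrow_gf n"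
proof (cases n)
  case (Suc m)
  have "2 * n - 1 = 2 * m + 1" by (simp add: Suc)
  moreover have "multiplicity 2 (2 * n) = Suc (multiplicity 2 n)"
    using Suc by (intro multiplicity_2_double) simp
  ultimately show ?thesis
    unfolding borrow_gf_def by (simp only: row_gf_odd) (simp add: Suc mult_ac)
qed (simp add: borrow_gf_0)

text \<open>As \<open>m\<close> and \<open>2 ^ k + m\<close> share their last \<open>k\<close>
  digits, both pairs (\<open>row_gf\<close>, \<open>borrow_gf\<close>) arise from those of 0 and 1
  by the same \<open>k\<close> matrices of determinant 2X; at 0 and 1 the determinant is 1.\<close>

lemma row_borrow_det:
  "m < 2 ^ k \<Longrightarrow>
    row_gf m * borrow_gf (2 ^ k + m) - row_gf (2 ^ k + m) * borrow_gf m = (2 * fps_X) ^ k"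
proof (induction k arbitrary: m)
  case 0
  have "borrow_gf 1 = 1" using borrow_gf_odd[of 0] by (simp add: row_gf_0 borrow_gf_0)
  with 0 show ?case by (simp add: row_gf_0 borrow_gf_0)
next
  case (Suc k)
  have det: "row_gf (m div 2) * borrow_gf (2 ^ k + m div 2) =
      row_gf (2 ^ k + m div 2) * borrow_gf (m div 2) + (2 * fps_X) ^ k"
    using Suc.IH[of "m div 2"] Suc.prems by (simp add: algebra_simps)
  show ?case
  proof (cases "even m")
    case True
    then have m: "m = 2 * (m div 2)" and h: "2 ^ Suc k + m = 2 * (2 ^ k + m div 2)" by auto
    have "row_gf m * borrow_gf (2 ^ Suc k + m) - row_gf (2 ^ Suc k + m) * borrow_gf m =
      (row_gf (m div 2) + fps_X * borrow_gf (m div 2)) * (2 * fps_X * borrow_gf (2 ^ k + m div 2))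
      - (row_gf (2 ^ k + m div 2) + fps_X * borrow_gf (2 ^ k + m div 2)) * (2 * fps_X * borrow_gf (m div 2))"
      unfolding h by (subst (1 2) m) (simp only: row_gf_even borrow_gf_even)
    also have "\<dots> = 2 * fps_X * (row_gf (m div 2) * borrow_gf (2 ^ k + m div 2)
        - row_gf (2 ^ k + m div 2) * borrow_gf (m div 2))"
      by (simp add: algebra_simps)
    finally show ?thesis using det by simp
  next
    case False
    then have m: "m = 2 * (m div 2) + 1" and h: "2 ^ Suc k + m = 2 * (2 ^ k + m div 2) + 1"
      by (auto elim!: oddE)
    have "row_gf m * borrow_gf (2 ^ Suc k + m) - row_gf (2 ^ Suc k + m) * borrow_gf m =
      (2 * row_gf (m div 2)) * (row_gf (2 ^ k + m div 2) + fps_X * borrow_gf (2 ^ k + m div 2))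
      - (2 * row_gf (2 ^ k + m div 2)) * (row_gf (m div 2) + fps_X * borrow_gf (m div 2))"
      unfolding h by (subst (1 2) m) (simp only: row_gf_odd borrow_gf_odd)
    also have "\<dots> = 2 * fps_X * (row_gf (m div 2) * borrow_gf (2 ^ k + m div 2)
        - row_gf (2 ^ k + m div 2) * borrow_gf (m div 2))"
      by (simp add: algebra_simps)
    finally show ?thesis using det by simp
  qed
qed

subsection \<open>Logarithmic derivatives\<close>

definition row_logderiv :: "nat \<Rightarrow> real fps" where
  "row_logderiv n = fps_deriv (row_gf n) * inverse (row_gf n)"

lemma fps_nth_row_gf_0: "fps_nth (row_gf n) 0 \<noteq> 0"
  using theta2_0_pos[of n] by (simp add: fps_nth_row_gf)

lemma row_logderiv_mult: "row_logderiv n * row_gf n = fps_deriv (row_gf n)"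
  unfolding row_logderiv_def
  by (simp add: mult.assoc inverse_mult_eq_1[OF fps_nth_row_gf_0])

lemma row_logderiv_0: "row_logderiv 0 = 0"
  by (simp add: row_logderiv_def row_gf_0)

lemma row_logderiv_odd: "row_logderiv (2 * n + 1) = row_logderiv n"
proof -
  have "row_gf (2 * n + 1) = fps_const 2 * row_gf n"
    using row_gf_odd[of n] by (simp add: fps_numeral_fps_const)
  then show ?thesis
    unfolding row_logderiv_def by (simp add: fps_inverse_mult fps_const_inverse mult_ac fps_const_mult)
qed

text \<open>
  The quotient \<open>T\<^sub>v T\<^sub>m / (T\<^sub>2\<^sub>m T\<^sub>h)\<close>, where \<open>v = 2\<^sup>k\<^sup>+\<^sup>1 + 2 m\<close> and \<open>h = 2\<^sup>k + m\<close>, is constant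
  up to order \<open>k + 1\<close>.
\<close>

lemma row_logderiv_second_difference:
  assumes "m < 2 ^ k" "i < k"
  shows "fps_nth (row_logderiv (2 * (2 ^ k + m)) - row_logderiv (2 ^ k + m)) i =
    fps_nth (row_logderiv (2 * m) - row_logderiv m) i"
proof -
  define h where "h = 2 ^ k + m"
  define A where "A = row_gf (2 * h) * row_gf m"
  define C where "C = row_gf (2 * m) * row_gf h"
  define q where "q = (fps_const (2 ^ k) :: real fps)"
  define r where "r = (fps_const (real (Suc k)) :: real fps)"
  define E where "E = q * fps_X ^ Suc k"
  \<comment> \<open>The products \<open>row_gf h * row_gf m\<close> cancel, which leaves X times the
    determinant of \<open>row_borrow_det\<close>.\<close>
  have "A - C = fps_X * (row_gf m * borrow_gf h - row_gf h * borrow_gf m)"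
    unfolding A_def C_def row_gf_even by (simp add: algebra_simps)
  also have "\<dots> = E"
    unfolding h_def row_borrow_det[OF assms(1)] E_def q_def
    by (simp add: power_mult_distrib fps_numeral_fps_const fps_const_power mult_ac)
  finally have AC: "A = C + E" by (simp add: algebra_simps)
  have "fps_deriv (fps_X ^ Suc k :: real fps) = r * fps_X ^ k"
    by (simp only: fps_deriv_power r_def) simp
  then have E': "fps_deriv E = q * (r * fps_X ^ k)"
    by (simp only: E_def q_def fps_deriv_mult_const_left)
  have "fps_deriv A * C - A * fps_deriv C =
      (row_logderiv (2 * h) - row_logderiv h - (row_logderiv (2 * m) - row_logderiv m)) * (A * C)"
    by (simp add: A_def C_def row_logderiv_mult[symmetric] algebra_simps)
  \<comment> \<open>With \<open>A = C + E\<close> only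
    \<open>fps_deriv E * C - E * fps_deriv C\<close> survives, and \<open>E\<close> and its
    derivative are divisible by \<open>fps_X ^ k\<close>.\<close>
  moreover have "fps_deriv A * C - A * fps_deriv C = fps_X ^ k * (q *
      (r * C - fps_X * fps_deriv C))"
    unfolding AC fps_deriv_add E' by (simp add: E_def algebra_simps)
  ultimately have prod: "(row_logderiv (2 * h) - row_logderiv h - (row_logderiv (2 * m) - row_logderiv m)) * (A * C) =
      fps_X ^ k * (q * (r * C - fps_X * fps_deriv C))"
    by simp
  \<comment> \<open>\<open>A * C\<close> is a unit, so dividing by it keeps the order at least
    \<open>k\<close>.\<close>
  have "fps_nth (A * C) 0 \<noteq> 0"
    by (simp add: A_def C_def fps_nth_row_gf_0)
  then have unit: "(A * C) * inverse (A * C) = 1"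
    by (subst mult.commute) (rule inverse_mult_eq_1)
  have "row_logderiv (2 * h) - row_logderiv h - (row_logderiv (2 * m) - row_logderiv m) =
      (row_logderiv (2 * h) - row_logderiv h - (row_logderiv (2 * m) - row_logderiv m)) * ((A * C) * inverse (A * C))"
    by (simp only: unit mult_1_right)
  also have "\<dots> = fps_X ^ k * (q * (r * C - fps_X * fps_deriv C) * inverse (A * C))"
    by (simp only: mult.assoc[symmetric] prod[unfolded mult.assoc[symmetric]])
  finally have "row_logderiv (2 * h) - row_logderiv h - (row_logderiv (2 * m) - row_logderiv m) =
      fps_X ^ k * (q * (r * C - fps_X * fps_deriv C) * inverse (A * C))" .
  then have "fps_nth (row_logderiv (2 * h) - row_logderiv h - (row_logderiv (2 * m) - row_logderiv m)) i = 0"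
    using assms(2) by (simp only: fps_X_power_mult_nth if_True)
  then show ?thesis by (simp add: h_def)
qed

text \<open>Row 2 is 1, 2, 1, so \<open>row_gf 2\<close> is 2 + X and the series is the geometric
  series of 1/(2 + X), the derivative of log(1 + X/2).\<close>

lemma fps_nth_row_logderiv_2: "fps_nth (row_logderiv 2) i = (- 1) ^ i * (1 / 2) ^ Suc i"
proof -
  have 1: "row_gf 1 = fps_const 2" "borrow_gf 1 = 1"
    using row_gf_odd[of 0] borrow_gf_odd[of 0]
    by (simp_all add: row_gf_0 borrow_gf_0 fps_numeral_fps_const)
  have 2: "row_gf 2 = fps_const 2 + fps_X"
    using row_gf_even[of 1] 1 by simp
  define D where "D = (Abs_fps (\<lambda>i. (- 1) ^ i * (1 / 2) ^ Suc i) :: real fps)"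
  have "D * row_gf 2 = 1"
    unfolding 2
  proof (rule fps_ext)
    fix n
    show "fps_nth (D * (fps_const 2 + fps_X)) n = fps_nth 1 n"
      by (cases n) (simp_all add: D_def distrib_left)
  qed
  moreover have "row_logderiv 2 * row_gf 2 = 1"
    unfolding row_logderiv_mult by (simp add: 2)
  moreover have "row_gf 2 \<noteq> 0"
    using fps_nth_row_gf_0[of 2] by auto
  ultimately have "row_logderiv 2 = D"
    by (metis mult_right_cancel)
  then show ?thesis by (simp add: D_def)
qed

subsection \<open>Words as numbers\<close>

text \<open>The reversal is needed as \<open>horner_sum\<close> takes the least significant digit
  first.\<close>

definition word_val :: "word \<Rightarrow> nat" where
  "word_val w = horner_sum of_bool 2 (rev w)"

lemma bit_word_val: "bit (word_val w) k \<longleftrightarrow> k < length w \<and> rev w ! k"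
  by (simp add: word_val_def bit_horner_sum_bit_iff)

lemma word_val_less: "word_val w < 2 ^ length w"
  using horner_sum_of_bool_2_less[of "rev w"] by (simp add: word_val_def)

lemma word_val_inj: "length v = length w \<Longrightarrow> word_val v = word_val w \<Longrightarrow> v = w"
proof -
  assume len: "length v = length w" and eq: "word_val v = word_val w"
  have "rev v = rev w"
  proof (rule nth_equalityI)
    fix i assume "i < length (rev v)"
    then show "rev v ! i = rev w ! i"
      using bit_word_val[of v i] bit_word_val[of w i] len unfolding eq by simp
  qed (simp add: len)
  then show "v = w" by simp
qed

lemma W_Cons: "w \<in> W \<Longrightarrow> \<exists>u. w = True # u \<and> u \<noteq> []"
  by (cases w) (auto simp: W_def)

lemma word_val_ge: "w \<in> W \<Longrightarrow> 2 ^ (length w - 1) \<le> word_val w"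
proof -
  assume "w \<in> W"
  then obtain u where w: "w = True # u" using W_Cons by auto
  have "bit (word_val w) (length w - 1)"
    by (auto simp: bit_word_val w nth_append)
  then have "word_val w div 2 ^ (length w - 1) \<noteq> 0"
    unfolding bit_iff_odd by (metis even_zero)
  then show ?thesis by (simp add: div_eq_0_iff)
qed

lemma word_val_pos: "w \<in> W \<Longrightarrow> 0 < word_val w"
  using word_val_ge[of w] by (auto intro!: Nat.gr0I)

lemma even_word_val: "w \<in> W \<Longrightarrow> even (word_val w)"
proof -
  assume "w \<in> W"
  then have "w \<noteq> []" "\<not> last w" by (auto simp: W_def)
  then have "\<not> bit (word_val w) 0"
    by (simp add: bit_word_val rev_nth last_conv_nth)
  then show ?thesis by (simp add: bit_0)
qed

lemma word_val_surj:
  assumes "even v" "2 ^ k \<le> v" "v < 2 ^ Suc k" "k > 0"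
  shows "\<exists>w\<in>W. length w = Suc k \<and> word_val w = v"
proof
  let ?w = "rev (map (bit v) [0..<Suc k])"
  show val: "length ?w = Suc k \<and> word_val ?w = v"
  proof
    have "word_val ?w = take_bit (Suc k) v"
      by (simp only: word_val_def rev_rev_ident horner_sum_bit_eq_take_bit)
    then show "word_val ?w = v"
      using assms(3) by (simp add: take_bit_nat_eq_self_iff)
  qed simp
  have "v div 2 ^ k = 1"
    using assms(2,3) by (intro div_nat_eqI) auto
  then have "bit v k"
    by (simp add: bit_iff_odd)
  moreover have "\<not> bit v 0"
    using assms(1) by (simp add: bit_0)
  ultimately show "?w \<in> W"
    using assms(4) by (auto simp: W_def last_rev upt_conv_Cons)
qed

section \<open>Occurrence counts through division with remainder\<close>

lemma occ_eq_card: "occ n w = card {i. (n div 2 ^ i) mod 2 ^ length w = word_val w}"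
proof -
  have "(\<forall>k<length w. bit n (i + k) = rev w ! k) \<longleftrightarrow> (n div 2 ^ i) mod 2 ^ length w = word_val w" for i
    unfolding take_bit_eq_mod[symmetric] drop_bit_eq_div[symmetric]
    by (auto simp: bit_eq_iff bit_take_bit_iff bit_drop_bit_eq bit_word_val)
  then show ?thesis by (simp add: occ_def)
qed

lemma finite_occurrences:
  fixes n :: nat
  assumes "w \<in> W"
  shows "finite {i. (n div 2 ^ i) mod 2 ^ length w = word_val w}"
proof (rule finite_subset)
  show "{i. (n div 2 ^ i) mod 2 ^ length w = word_val w} \<subseteq> {..n}"
  proof (rule subsetI, rule ccontr)
    fix i assume i: "i \<in> {i. (n div 2 ^ i) mod 2 ^ length w = word_val w}" and "i \<notin> {..n}"
    then have "n < 2 ^ i"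
      using less_trans[OF _ less_exp[of i]] by simp
    with i word_val_pos[OF assms] show False by simp
  qed
qed simp

text \<open>Position 0 is split off; the other windows are those of \<open>n div 2\<close>. The
  leading 1 of \<open>w\<close> makes the set of positions finite, so cardinalities add.\<close>

lemma occ_rec:
  assumes "w \<in> W"
  shows "occ n w = of_bool (n mod 2 ^ length w = word_val w) + occ (n div 2) w"
proof -
  let ?S = "\<lambda>n. {i. (n div 2 ^ i) mod 2 ^ length w = word_val w}"
  have "?S n = {i. i = 0 \<and> n mod 2 ^ length w = word_val w} \<union> Suc ` ?S (n div 2)"
  proof (intro set_eqI)
    fix i
    have "n div 2 ^ Suc j = n div 2 div 2 ^ j" for j
      by (simp add: div_mult2_eq)
    then show "i \<in> ?S n \<longleftrightarrow> i \<in> {i. i = 0 \<and> n mod 2 ^ length w = word_val w} \<union> Suc ` ?S (n div 2)"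
      by (cases i) (simp_all add: image_iff del: power_Suc)
  qed
  moreover have "card (Suc ` ?S (n div 2)) = card (?S (n div 2))"
    by (simp add: card_image)
  moreover have "finite (?S (n div 2))"
    by (rule finite_occurrences[OF assms])
  ultimately show ?thesis
    unfolding occ_eq_card by (subst card_Un_disjoint[symmetric] | simp)+
qed

lemma occ_0 [simp]: "w \<in> W \<Longrightarrow> occ 0 w = 0"
  using word_val_pos[of w] by (simp add: occ_eq_card)

lemma occ_odd: "w \<in> W \<Longrightarrow> occ (2 * n + 1) w = occ n w"
proof -
  assume w: "w \<in> W"
  have "2 dvd (2 ^ length w :: nat)"
    using w by (auto simp: W_def)
  then have "odd ((2 * n + 1) mod 2 ^ length w)"
    by (subst dvd_mod_iff) auto
  with even_word_val[OF w] have "(2 * n + 1) mod 2 ^ length w \<noteq> word_val w" by auto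
  then show ?thesis
    using occ_rec[OF w, of "2 * n + 1"] by simp
qed

lemma occ_eq_0: "w \<in> W \<Longrightarrow> n < word_val w \<Longrightarrow> occ n w = 0"
proof (induction n rule: less_induct)
  case (less n)
  show ?case
  proof (cases "n = 0")
    case False
    then have "occ (n div 2) w = 0" using less by (intro less.IH) auto
    moreover have "n mod 2 ^ length w \<noteq> word_val w"
      using less.prems(2) by (metis mod_less_eq_dividend not_le)
    ultimately show ?thesis using occ_rec[OF less.prems(1), of n] by simp
  qed (use less in simp)
qed

text \<open>A window of length at most \<open>K\<close> starting below position \<open>L\<close>
  ends below the block \<open>b\<close>; windows starting higher see only
  \<open>2 ^ K * b\<close>.\<close>

lemma occ_append_block:
  assumes "w \<in> W" "length w \<le> K" "n < 2 ^ L"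
  shows "occ (n + 2 ^ (L + K) * b) w = occ n w + occ (2 ^ K * b) w"
  using assms(3)
proof (induction L arbitrary: n)
  case (Suc L)
  have "2 ^ length w dvd (2 ^ (Suc L + K) * b :: nat)"
    using assms(2) by (intro dvd_mult2 le_imp_power_dvd) simp
  then have "(n + 2 ^ (Suc L + K) * b) mod 2 ^ length w = n mod 2 ^ length w"
    by (metis add_0_right dvd_imp_mod_0 mod_add_right_eq)
  moreover have "(n + 2 ^ (Suc L + K) * b) div 2 = n div 2 + 2 ^ (L + K) * b"
    by simp
  moreover have "n div 2 < 2 ^ L" using Suc.prems by simp
  ultimately show ?case
    using Suc.IH[of "n div 2"] occ_rec[OF assms(1), of n] occ_rec[OF assms(1), of "n + 2 ^ (Suc L + K) * b"]
    by simp
qed (use assms in simp)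

text \<open>Since \<open>w\<close> begins with 1, a new occurrence must have its first letter at
  position \<open>M\<close>, which leaves a single candidate window.\<close>

lemma occ_leading_bit:
  assumes "w \<in> W" "n < 2 ^ M" "length w \<le> Suc M"
  shows "occ (2 ^ M + n) w = occ n w + of_bool ((2 ^ M + n) div 2 ^ (Suc M - length w) = word_val w)"
  using assms(2,3)
proof (induction M arbitrary: n)
  case 0
  with assms(1) show ?case by (simp add: W_def)
next
  case (Suc M)
  show ?case
  proof (cases "length w = Suc (Suc M)")
    case True
    then have ge: "2 ^ Suc M \<le> word_val w"
      using word_val_ge[OF assms(1)] by simp
    have "occ n w = 0" "occ ((2 ^ Suc M + n) div 2) w = 0"
      using ge Suc.prems(1) by (intro occ_eq_0 assms(1); simp)+
    moreover have "(2 ^ Suc M + n) mod 2 ^ length w = 2 ^ Suc M + n"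
      using Suc.prems(1) True by simp
    ultimately show ?thesis
      using occ_rec[OF assms(1), of "2 ^ Suc M + n"] True by simp
  next
    case False
    then have len: "length w \<le> Suc M" using Suc.prems by simp
    have "2 ^ length w dvd (2 ^ Suc M :: nat)"
      using len by (intro le_imp_power_dvd)
    then have "(2 ^ Suc M + n) mod 2 ^ length w = n mod 2 ^ length w"
      by (metis add_0_left dvd_imp_mod_0 mod_add_left_eq)
    moreover have half: "(2 ^ Suc M + n) div 2 = 2 ^ M + n div 2" by simp
    moreover have "(2 ^ Suc M + n) div 2 ^ (Suc (Suc M) - length w) =
        (2 ^ M + n div 2) div 2 ^ (Suc M - length w)"
      unfolding half[symmetric] using len by (simp add: Suc_diff_le div_mult2_eq)
    moreover have "n div 2 < 2 ^ M" using Suc.prems by simp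
    ultimately show ?thesis
      using Suc.IH[of "n div 2"] len occ_rec[OF assms(1), of n] occ_rec[OF assms(1), of "2 ^ Suc M + n"]
      by simp
  qed
qed

subsection \<open>Uniqueness\<close>

definition short_words :: "nat \<Rightarrow> word set" where
  "short_words K = {w \<in> W. length w \<le> K}"

lemma finite_short_words [simp]: "finite (short_words K)"
proof (rule finite_subset)
  show "short_words K \<subseteq> {w. set w \<subseteq> UNIV \<and> length w \<le> K}"
    by (auto simp: short_words_def)
  show "finite {w :: word. set w \<subseteq> UNIV \<and> length w \<le> K}"
    by (rule finite_lists_length_le) simp
qed

text \<open>Keeping finitely many coordinates allows them to be adjusted one at a time.\<close>

definition occ_closure :: "nat \<Rightarrow> (word \<Rightarrow> real) set" where
  "occ_closure K = zariski_closure (short_words K) (range (\<lambda>n w. real (occ n w)))"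

lemma occ_closure_block:
  assumes "x \<in> occ_closure K"
  shows "(\<lambda>w. x w + t * real (occ (2 ^ K * b) w)) \<in> occ_closure K"
  unfolding occ_closure_def
proof (rule zariski_closure_line)
  fix s assume "s \<in> range (\<lambda>n w. real (occ n w))"
  then obtain n where s: "s = (\<lambda>w. real (occ n w))" by auto
  \<comment> \<open>Any length bounding the digits of \<open>n\<close> would do; \<open>n\<close>
    itself is the simplest.\<close>
  have "n < 2 ^ n" by simp
  then have "\<forall>w\<in>short_words K. real (occ (n + 2 ^ (n + K) * b) w) = s w + real (occ (2 ^ K * b) w)"
    using occ_append_block[of _ K n n b] by (auto simp: s short_words_def)
  then show "\<exists>s'\<in>range (\<lambda>n w. real (occ n w)). \<forall>w\<in>short_words K. s' w = s w + real (occ (2 ^ K * b) w)"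
    by (intro bexI[of _ "\<lambda>w. real (occ (n + 2 ^ (n + K) * b) w)"]) auto
qed (use assms in \<open>simp add: occ_closure_def\<close>)

lemma append_ones_div: "(c * 2 ^ d + (2 ^ d - 1)) div 2 ^ d = (c :: nat)"
proof -
  obtain e where "2 ^ d = Suc e" by (metis not0_implies_Suc power_not_zero zero_neq_numeral)
  moreover have "(c * Suc e + e) div Suc e = c + e div Suc e"
    by (rule div_mult_self3) simp
  ultimately show ?thesis by (simp del: mult_Suc_right)
qed

lemma append_ones_add:
  "(c * 2 ^ (m + j) + (2 ^ (m + j) - 1) :: nat) = (c * 2 ^ j + (2 ^ j - 1)) * 2 ^ m + (2 ^ m - 1)"
proof -
  obtain e f where "2 ^ m = Suc e" "2 ^ j = Suc f"
    by (metis not0_implies_Suc power_not_zero zero_neq_numeral)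
  then show ?thesis by (simp add: power_add algebra_simps)
qed

text \<open>
  Among the words of length at most \<open>K\<close>, the numbers \<open>b\<close> and \<open>b + 2\<^bsup>K-k\<^esup>\<close> with binary
  expansions \<open>v 1\<dots>1\<close> and \<open>v' 1\<dots>1\<close>, where \<open>v'\<close> is \<open>v\<close> with its last digit raised to 1, have
  the same prefixes ending in 0, with the exception of \<open>v\<close> itself.
\<close>

lemma block_second_difference:
  fixes v :: word
  assumes v: "v \<in> short_words K" and w: "w \<in> short_words K"
  defines "b \<equiv> word_val v * 2 ^ (K - length v) + (2 ^ (K - length v) - 1)"
  defines "b' \<equiv> b + 2 ^ (K - length v)"
  defines "T \<equiv> 2 ^ (K - 1)"
  shows "real (occ (2 ^ K * b) w) - real (occ (2 ^ K * (b - T)) w)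
      - real (occ (2 ^ K * b') w) + real (occ (2 ^ K * (b' - T)) w) = of_bool (w = v)"
proof -
  define k where "k = length v"
  define l where "l = length w"
  define a where "a = word_val v"
  define d where "d = K - k"
  have W: "v \<in> W" "w \<in> W" and kK: "k \<le> K" "l \<le> K" and k2: "2 \<le> k" "2 \<le> l"
    using v w by (auto simp: short_words_def k_def l_def W_def)
  have a: "2 ^ (k - 1) \<le> a" "a < 2 ^ k" "even a"
    using word_val_ge[OF W(1)] word_val_less[of v] even_word_val[OF W(1)] by (auto simp: a_def k_def)
  \<comment> \<open>As \<open>a\<close> is even, raising its last digit to 1 causes no
    carry.\<close>
  then have a1: "a + 1 < 2 ^ k"
    using k2 by (metis Suc_eq_plus1 Suc_lessI even_Suc even_power even_numeral less_le_trans pos2)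
  have b: "b = a * 2 ^ d + (2 ^ d - 1)" and b': "b' = (a + 1) * 2 ^ d + (2 ^ d - 1)"
    by (simp_all add: b_def b'_def a_def d_def k_def algebra_simps)
  have T: "T = 2 ^ (k - 1) * 2 ^ d"
    using k2 kK by (simp add: T_def d_def flip: power_add)
  have leading: "T \<le> c * 2 ^ d + (2 ^ d - 1)" "c * 2 ^ d + (2 ^ d - 1) < 2 * T"
    if "2 ^ (k - 1) \<le> c" "c < 2 ^ k" for c
  proof -
    have "2 ^ (k - 1) * 2 ^ d \<le> c * 2 ^ d" using that(1) by simp
    then show "T \<le> c * 2 ^ d + (2 ^ d - 1)" unfolding T by linarith
    have "(c + 1) * 2 ^ d \<le> 2 ^ k * 2 ^ d" using that(2) by (intro mult_right_mono) auto
    moreover have "2 ^ k * 2 ^ d = 2 * T"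
      unfolding T mult.assoc[symmetric] power_Suc[symmetric] using k2 by simp
    moreover have "c * 2 ^ d + (2 ^ d - 1) < (c + 1) * 2 ^ d"
      unfolding distrib_right mult_1 by (rule add_strict_left_mono) simp
    ultimately show "c * 2 ^ d + (2 ^ d - 1) < 2 * T" by linarith
  qed
  \<comment> \<open>Subtracting \<open>T\<close> deletes the leading 1 of the \<open>K\<close>-digit
    number \<open>c\<close>, so the difference only tests whether \<open>w\<close> is a prefix of
    \<open>c\<close>.\<close>
  have diff: "real (occ (2 ^ K * c) w) - real (occ (2 ^ K * (c - T)) w) = of_bool (c div 2 ^ (K - l) = word_val w)"
    if c: "T \<le> c" "c < 2 * T" for c
  proof -
    define M where "M = K + (K - 1)"
    have K: "Suc M - l = K + (K - l)" using kK k2 by (simp add: M_def)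
    have "2 ^ K * c = 2 ^ M + 2 ^ K * (c - T)"
      using c by (simp add: M_def power_add T_def right_diff_distrib')
    moreover have "2 ^ K * (c - T) < 2 ^ M"
      using c by (simp add: M_def power_add T_def)
    moreover have "2 ^ K * c div 2 ^ (Suc M - l) = c div 2 ^ (K - l)"
      unfolding K by (simp add: power_add div_mult2_eq)
    ultimately show ?thesis
      using occ_leading_bit[OF W(2), of "2 ^ K * (c - T)" M] kK by (simp add: l_def M_def)
  qed
  \<comment> \<open>For \<open>l = k\<close> the prefixes are \<open>a\<close> and the odd
    \<open>a + 1\<close>; shorter prefixes omit the last digit of \<open>a\<close> and agree; longer
    ones end in an appended 1 and match no word of \<open>W\<close>.\<close>
  have "of_bool (b div 2 ^ (K - l) = word_val w) - of_bool (b' div 2 ^ (K - l) = word_val w) = (of_bool (w = v) :: real)"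
  proof (cases "l = k")
    case True
    have "b div 2 ^ (K - l) = a" "b' div 2 ^ (K - l) = a + 1"
      unfolding b b' True unfolding d_def[symmetric] append_ones_div by simp_all
    moreover have "a + 1 \<noteq> word_val w"
      using a(3) even_word_val[OF W(2)] by (metis even_plus_one_iff)
    moreover have "a = word_val w \<longleftrightarrow> w = v"
      using word_val_inj[of v w] True by (auto simp: a_def k_def l_def)
    ultimately show ?thesis by simp
  next
    case False
    then have wv: "w \<noteq> v" by (auto simp: k_def l_def)
    show ?thesis
    proof (cases "l < k")
      case True
      then have "K - l = d + Suc (k - l - 1)" using kK by (simp add: d_def)
      then have "x div 2 ^ (K - l) = x div 2 ^ d div 2 div 2 ^ (k - l - 1)" for x :: nat
        by (simp only: power_add power_Suc div_mult2_eq)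
      moreover have "b div 2 ^ d = a" "b' div 2 ^ d = a + 1"
        unfolding b b' append_ones_div by simp_all
      ultimately have "b div 2 ^ (K - l) = b' div 2 ^ (K - l)"
        using a(3) by simp
      then show ?thesis using wv by simp
    next
      case l: False
      then have d: "d = K - l + Suc (l - k - 1)" using False kK by (simp add: d_def)
      have odd: "odd ((c * 2 ^ d + (2 ^ d - 1)) div 2 ^ (K - l))" for c :: nat
      proof -
        have "(c * 2 ^ d + (2 ^ d - 1)) div 2 ^ (K - l) = c * 2 ^ Suc (l - k - 1) + (2 ^ Suc (l - k - 1) - 1)"
          unfolding d append_ones_add append_ones_div ..
        then show ?thesis by simp
      qed
      have "b div 2 ^ (K - l) \<noteq> word_val w" "b' div 2 ^ (K - l) \<noteq> word_val w"
        using odd[of a, folded b] odd[of "a + 1", folded b'] even_word_val[OF W(2)] by metis+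
      then show ?thesis using wv by simp
    qed
  qed
  then show ?thesis
    using diff[OF leading[of a, folded b]] diff[OF leading[of "a + 1", folded b']] a a1 by simp
qed

text \<open>Real multiples of block vectors may be added, so the alternating combination of the four
  blocks in \<open>block_second_difference\<close> is available.\<close>

lemma occ_closure_unit:
  assumes "x \<in> occ_closure K" "v \<in> short_words K"
  shows "(\<lambda>w. x w + t * of_bool (w = v)) \<in> occ_closure K"
proof -
  define b where "b = word_val v * 2 ^ (K - length v) + (2 ^ (K - length v) - 1)"
  define b' where "b' = b + 2 ^ (K - length v)"
  define T :: nat where "T = 2 ^ (K - 1)"
  define d where "d c w = real (occ (2 ^ K * c) w)" for c w
  have "(\<lambda>w. x w + t * d b w + - t * d (b - T) w + - t * d b' w + t * d (b' - T) w) \<in> occ_closure K"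
    unfolding d_def by (intro occ_closure_block assms)
  moreover have "x w + t * d b w + - t * d (b - T) w + - t * d b' w + t * d (b' - T) w =
      x w + t * of_bool (w = v)" if w: "w \<in> short_words K" for w
    unfolding block_second_difference[OF assms(2) w, symmetric]
    by (simp add: d_def b_def b'_def T_def algebra_simps)
  ultimately show ?thesis
    unfolding occ_closure_def by (rule zariski_closure_cong)
qed

lemma occ_closure_UNIV: "x \<in> occ_closure K"
proof -
  have restrict: "(\<lambda>w. if w \<in> U then x w else 0) \<in> occ_closure K" if "finite U" "U \<subseteq> short_words K" for U
    using that
  proof (induction U rule: finite_induct)
    case empty
    have "(\<lambda>w. real (occ 0 w)) \<in> occ_closure K"
      by (auto simp: occ_closure_def zariski_closure_def)
    then show ?case
      unfolding occ_closure_def by (rule zariski_closure_cong) (auto simp: short_words_def)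
  next
    case (insert v U)
    have "(\<lambda>w. (if w \<in> U then x w else 0) + x v * of_bool (w = v)) \<in> occ_closure K"
      using insert by (intro occ_closure_unit) auto
    moreover have "(\<lambda>w. (if w \<in> U then x w else 0) + x v * of_bool (w = v)) = (\<lambda>w. if w \<in> insert v U then x w else 0)"
      using insert.hyps by auto
    ultimately show ?case by simp
  qed
  have "(\<lambda>w. if w \<in> short_words K then x w else 0) \<in> occ_closure K"
    by (rule restrict) auto
  then show ?thesis
    unfolding occ_closure_def by (rule zariski_closure_cong) simp
qed

lemma word_poly_eqI:
  assumes "variables P \<subseteq> W" "variables Q \<subseteq> W"
    and eq: "\<And>n. eval_poly P (\<lambda>w. real (occ n w)) = eval_poly Q (\<lambda>w. real (occ n w))"
  shows "P = Q"
proof -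
  \<comment> \<open>The inserted 0 keeps \<open>Max\<close> meaningful when \<open>P - Q\<close> has
    no variables.\<close>
  define K where "K = Max (insert 0 (length ` variables (P - Q)))"
  have "variables (P - Q) \<subseteq> short_words K"
    using assms(1,2) variables_diff_subset[of P Q] by (auto simp: short_words_def K_def)
  then have "polyfun (short_words K) (eval_poly (P - Q))"
    by (rule polyfun_eval_poly)
  moreover have "\<forall>s\<in>range (\<lambda>n w. real (occ n w)). eval_poly (P - Q) s = 0"
    by (auto simp: eval_poly_diff eq)
  ultimately have "eval_poly (P - Q) x = 0" for x
    using occ_closure_UNIV[of x K] unfolding occ_closure_def zariski_closure_def by blast
  then have "P - Q = 0" by (rule eval_poly_eq_zero_imp_zero)
  then show ?thesis by simp
qed

subsection \<open>Existence\<close>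

text \<open>
  The logarithmic derivative of \<open>T\<^sub>w T\<^sub>w\<^sub>L\<^sub>R / (T\<^sub>w\<^sub>L T\<^sub>w\<^sub>R)\<close>, where \<open>w\<^sub>L\<close> and \<open>w\<^sub>R\<close>
  arise from \<open>w\<close> by deleting the first and the last letter.
\<close>

definition word_weight :: "word \<Rightarrow> real fps" where
  "word_weight w = row_logderiv (word_val w) - row_logderiv (word_val w div 2)
     - (row_logderiv (word_val w mod 2 ^ (length w - 1))
        - row_logderiv (word_val w mod 2 ^ (length w - 1) div 2))"

text \<open>If digit \<open>k\<close> of \<open>n\<close> is 1, exactly one word of this length
  matches the end of \<open>2 * n\<close>; if it is 0, none does and the right side
  vanishes.\<close>

lemma sum_matching_words:
  "(\<Sum>w\<in>{w \<in> W. length w = Suc (Suc k)}. of_bool ((2 * n) mod 2 ^ length w = word_val w) * fps_nth (word_weight w) i) =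
    fps_nth (row_logderiv (2 * (n mod 2 ^ Suc k)) - row_logderiv (n mod 2 ^ Suc k)) i -
    fps_nth (row_logderiv (2 * (n mod 2 ^ k)) - row_logderiv (n mod 2 ^ k)) i"
  (is "?lhs = ?rhs")
proof -
  define A where "A = {w \<in> W. length w = Suc (Suc k)}"
  have fin: "finite A"
    by (rule finite_subset[OF _ finite_short_words[of "Suc (Suc k)"]]) (auto simp: A_def short_words_def)
  have double: "(2 * n) mod 2 ^ Suc j = 2 * (n mod 2 ^ j)" for j
    by simp
  have lhs: "?lhs = (\<Sum>w\<in>A. of_bool (2 * (n mod 2 ^ Suc k) = word_val w) * fps_nth (word_weight w) i)"
    unfolding A_def by (rule sum.cong) (simp_all only: mem_Collect_eq double)
  have mod_mod: "n mod 2 ^ Suc k mod 2 ^ k = n mod 2 ^ k"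
    by (simp add: mod_mod_cancel)
  show ?thesis
  proof (cases "n mod 2 ^ Suc k < 2 ^ k")
    case True
    then have "n mod 2 ^ Suc k = n mod 2 ^ k"
      using mod_mod by simp
    moreover have "2 * (n mod 2 ^ Suc k) \<noteq> word_val w" if "w \<in> A" for w
      using that word_val_ge[of w] True by (auto simp: A_def)
    ultimately show ?thesis unfolding lhs by simp
  next
    case False
    obtain w0 where w0: "w0 \<in> W" "length w0 = Suc (Suc k)" "word_val w0 = 2 * (n mod 2 ^ Suc k)"
      using word_val_surj[of "2 * (n mod 2 ^ Suc k)" "Suc k"] False by auto
    have "2 * (n mod 2 ^ Suc k) = word_val w \<longleftrightarrow> w = w0" if "w \<in> A" for w
      using that w0 word_val_inj[of w w0] by (auto simp: A_def)
    then have "?lhs = (\<Sum>w\<in>A. if w = w0 then fps_nth (word_weight w) i else 0)"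
      unfolding lhs by (intro sum.cong) auto
    also have "\<dots> = fps_nth (word_weight w0) i"
      using fin w0 by (simp add: A_def)
    also have "2 * (n mod 2 ^ Suc k) mod 2 ^ Suc k = 2 * (n mod 2 ^ k)"
      using mod_mod by simp
    then have "word_weight w0 = row_logderiv (2 * (n mod 2 ^ Suc k)) - row_logderiv (n mod 2 ^ Suc k)
        - (row_logderiv (2 * (n mod 2 ^ k)) - row_logderiv (n mod 2 ^ k))"
      unfolding word_weight_def w0 by simp
    finally show ?thesis by simp
  qed
qed

lemma short_words_Suc:
  "short_words (Suc k) = short_words k \<union> {w \<in> W. length w = Suc k}"
  by (auto simp: short_words_def)

text \<open>The increments of \<open>sum_matching_words\<close> telescope over the word
  length.\<close>

lemma sum_short_words:
  "(\<Sum>w\<in>short_words (Suc k). of_bool ((2 * n) mod 2 ^ length w = word_val w) * fps_nth (word_weight w) i) =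
    fps_nth (row_logderiv (2 * (n mod 2 ^ k)) - row_logderiv (n mod 2 ^ k)) i"
proof (induction k)
  case 0
  have "short_words (Suc 0) = {}" by (auto simp: short_words_def W_def)
  then show ?case by simp
next
  case (Suc k)
  have "finite {w \<in> W. length w = Suc (Suc k)}"
    by (rule finite_subset[OF _ finite_short_words[of "Suc (Suc k)"]]) (auto simp: short_words_def)
  moreover have "short_words (Suc k) \<inter> {w \<in> W. length w = Suc (Suc k)} = {}"
    by (auto simp: short_words_def)
  ultimately show ?case
    unfolding short_words_Suc[of "Suc k"]
    by (simp only: sum.union_disjoint finite_short_words Suc.IH sum_matching_words)
qed

text \<open>By \<open>row_logderiv_second_difference\<close>, a digit at position \<open>k\<close>
  or higher does not affect coefficient \<open>i\<close>.\<close>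

lemma row_logderiv_suffix:
  assumes "i < k"
  shows "fps_nth (row_logderiv (2 * n) - row_logderiv n) i =
    fps_nth (row_logderiv (2 * (n mod 2 ^ k)) - row_logderiv (n mod 2 ^ k)) i"
proof -
  have step: "fps_nth (row_logderiv (2 * (n mod 2 ^ Suc j)) - row_logderiv (n mod 2 ^ Suc j)) i =
      fps_nth (row_logderiv (2 * (n mod 2 ^ j)) - row_logderiv (n mod 2 ^ j)) i" if "i < j" for j
  proof -
    have mod_mod: "n mod 2 ^ Suc j mod 2 ^ j = n mod 2 ^ j"
      by (simp add: mod_mod_cancel)
    show ?thesis
    proof (cases "n mod 2 ^ Suc j < 2 ^ j")
      case True
      then have "n mod 2 ^ Suc j = n mod 2 ^ j"
        using mod_mod by simp
      then show ?thesis by simp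
    next
      case False
      have "n mod 2 ^ Suc j < 2 * 2 ^ j" using pos_mod_bound by simp
      then have "n mod 2 ^ Suc j - 2 ^ j < 2 ^ j" using False by linarith
      then have "(n mod 2 ^ Suc j - 2 ^ j) mod 2 ^ j = n mod 2 ^ Suc j - 2 ^ j"
        by (rule mod_less)
      then have "n mod 2 ^ Suc j = 2 ^ j + n mod 2 ^ j"
        using False mod_mod le_mod_geq[of "2 ^ j" "n mod 2 ^ Suc j"] by linarith
      then show ?thesis
        using row_logderiv_second_difference[of "n mod 2 ^ j" j i] that by simp
    qed
  qed
  have "fps_nth (row_logderiv (2 * (n mod 2 ^ (k + d))) - row_logderiv (n mod 2 ^ (k + d))) i =
      fps_nth (row_logderiv (2 * (n mod 2 ^ k)) - row_logderiv (n mod 2 ^ k)) i" for d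
  proof (induction d)
    case (Suc d)
    have "i < k + d" using assms by simp
    from step[OF this] Suc.IH show ?case by (simp only: add_Suc_right)
  qed simp
  moreover have "n < 2 ^ (k + n)"
    by (rule less_le_trans[OF less_exp power_increasing]) simp_all
  then have "n mod 2 ^ (k + n) = n" by (rule mod_less)
  ultimately show ?thesis by metis
qed

text \<open>A final digit 1 changes neither side; a final 0 adds to both the weights of the words
  that end there.\<close>

lemma fps_nth_row_logderiv:
  "fps_nth (row_logderiv n) i = (\<Sum>w\<in>short_words (i + 2). real (occ n w) * fps_nth (word_weight w) i)"
proof (induction n rule: less_induct)
  case (less n)
  show ?case
  proof (cases "even n")
    case False
    then obtain m where n: "n = 2 * m + 1" by (elim oddE)
    show ?thesis
      unfolding n row_logderiv_odd using less.IH[of m] n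
      by (auto simp: short_words_def occ_odd[simplified] intro!: sum.cong)
  next
    case True
    then obtain m where n: "n = 2 * m" by (elim evenE)
    show ?thesis
    proof (cases "m = 0")
      case True
      then show ?thesis by (simp add: n row_logderiv_0 short_words_def)
    next
      case False
      have "fps_nth (row_logderiv n) i =
          fps_nth (row_logderiv (2 * m) - row_logderiv m) i + fps_nth (row_logderiv m) i"
        by (simp add: n)
      also have "fps_nth (row_logderiv (2 * m) - row_logderiv m) i =
          (\<Sum>w\<in>short_words (i + 2). of_bool ((2 * m) mod 2 ^ length w = word_val w) * fps_nth (word_weight w) i)"
        \<comment> \<open>The suffix length \<open>Suc i\<close> is the least admissible one and
          gives the bound \<open>i + 2\<close> on word lengths.\<close>
        unfolding add_2_eq_Suc' by (rule trans[OF row_logderiv_suffix[OF lessI] sum_short_words[symmetric]])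
      also have "fps_nth (row_logderiv m) i = (\<Sum>w\<in>short_words (i + 2). real (occ m w) * fps_nth (word_weight w) i)"
        using False by (intro less.IH) (simp add: n)
      finally show ?thesis
        unfolding sum.distrib[symmetric]
      proof (rule trans, intro sum.cong refl)
        fix w assume "w \<in> short_words (i + 2)"
        then have "occ n w = of_bool ((2 * m) mod 2 ^ length w = word_val w) + occ m w"
          using occ_rec[of w n] by (simp add: n short_words_def)
        then show "of_bool ((2 * m) mod 2 ^ length w = word_val w) * fps_nth (word_weight w) i +
            real (occ m w) * fps_nth (word_weight w) i = real (occ n w) * fps_nth (word_weight w) i"
          by (simp add: distrib_right)
      qed
    qed
  qed
qed

section \<open>From the logarithmic derivative to the polynomials\<close>

lemma theta2_rec:
  "real (Suc j) * real (theta2 (Suc j) n) =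
    (\<Sum>i\<le>j. fps_nth (row_logderiv n) i * real (theta2 (j - i) n))"
  using arg_cong[OF row_logderiv_mult[of n], of "\<lambda>f. fps_nth f j"]
  by (simp add: fps_mult_nth fps_nth_row_gf atLeast0AtMost)

text \<open>
  The recursion is the coefficientwise form of \<open>F' = D F\<close>, with the logarithmic derivative
  \<open>D\<close> replaced by the linear form in the variables that represents it.
\<close>

fun word_poly_theta :: "nat \<Rightarrow> word_poly" where
  "word_poly_theta 0 = 1"
| "word_poly_theta (Suc j) = (\<Sum>i\<in>{..j}. \<Sum>w\<in>short_words (i + 2).
     Poly_Mapping.single (Poly_Mapping.single w 1) (fps_nth (word_weight w) i / real (Suc j))
       * word_poly_theta (j - i))"

declare word_poly_theta.simps(2) [simp del]

lemma variables_word_poly_theta: "variables (word_poly_theta j) \<subseteq> W"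
proof (induction j rule: less_induct)
  case (less j)
  show ?case
  proof (cases j)
    case (Suc k)
    let ?s = "\<lambda>i w. Poly_Mapping.single (Poly_Mapping.single w 1) (fps_nth (word_weight w) i / real (Suc k))"
    have "variables (?s i w * word_poly_theta (k - i)) \<subseteq> W" if "w \<in> short_words (i + 2)" for i w
    proof -
      have "variables (?s i w) \<subseteq> W"
        using variables_single_subset[of "Poly_Mapping.single w 1"] that
        by (fastforce simp: short_words_def)
      moreover have "variables (word_poly_theta (k - i)) \<subseteq> W"
        by (rule less.IH) (simp add: Suc)
      ultimately show ?thesis
        using variables_mult_subset[of "?s i w" "word_poly_theta (k - i)"] by blast
    qed
    then show ?thesis
      unfolding Suc word_poly_theta.simps
      by (intro order_trans[OF variables_sum_subset] UN_least)
  qed simp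
qed

text \<open>The recursion \<open>theta2_rec\<close> is linear, hence survives division by
  \<open>theta2 0 n\<close>, and both sides start with 1.\<close>

lemma eval_word_poly_theta:
  "eval_poly (word_poly_theta j) (\<lambda>w. real (occ n w)) = real (theta2 j n) / real (theta2 0 n)"
proof (induction j rule: less_induct)
  case (less j)
  show ?case
  proof (cases j)
    case 0
    then show ?thesis using theta2_0_pos[of n] by simp
  next
    case (Suc k)
    have "eval_poly (word_poly_theta j) (\<lambda>w. real (occ n w)) =
        (\<Sum>i\<le>k. \<Sum>w\<in>short_words (i + 2). fps_nth (word_weight w) i / real (Suc k) * real (occ n w)
          * (real (theta2 (k - i) n) / real (theta2 0 n)))"
      unfolding Suc word_poly_theta.simps eval_poly_sum eval_poly_mult
      by (intro sum.cong refl, subst less.IH) (simp_all add: Suc)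
    also have "\<dots> = (\<Sum>i\<le>k. fps_nth (row_logderiv n) i * real (theta2 (k - i) n))
        / (real (Suc k) * real (theta2 0 n))"
      unfolding fps_nth_row_logderiv sum_divide_distrib sum_distrib_right
      by (intro sum.cong refl) simp
    also have "\<dots> = real (theta2 j n) / real (theta2 0 n)"
      unfolding theta2_rec[symmetric] Suc by simp
    finally show ?thesis .
  qed
qed

lemma theta_poly_eq: "theta_poly j = word_poly_theta j"
  unfolding theta_poly_def
proof (rule the_equality)
  show "variables (word_poly_theta j) \<subseteq> W \<and> (\<forall>n. real (theta2 j n) / real (theta2 0 n) =
      eval_poly (word_poly_theta j) (\<lambda>w. real (occ n w)))"
    by (simp add: variables_word_poly_theta eval_word_poly_theta)
next
  fix Q
  assume "variables Q \<subseteq> W \<and> (\<forall>n. real (theta2 j n) / real (theta2 0 n) = eval_poly Q (\<lambda>w. real (occ n w)))"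
  then show "Q = word_poly_theta j"
    by (intro word_poly_eqI) (simp_all add: variables_word_poly_theta eval_word_poly_theta)
qed

subsection \<open>The coefficient\<close>

text \<open>For positive \<open>j\<close> every term of the recursion carries a variable.\<close>

lemma lookup_word_poly_theta_0: "Poly_Mapping.lookup (word_poly_theta j) 0 = of_bool (j = 0)"
proof (cases j)
  case (Suc k)
  show ?thesis
    unfolding Suc word_poly_theta.simps lookup_sum lookup_variable_mult_zero by simp
qed (simp add: lookup_one)

text \<open>Deleting letters from 10 leaves 1 or 0, whose row series are constant and have
  logarithmic derivative 0.\<close>

lemma word_weight_10: "word_weight [True, False] = row_logderiv 2"
proof -
  have "word_val [True, False] = 2" by (simp add: word_val_def)
  moreover have "row_logderiv 1 = 0"
    using row_logderiv_odd[of 0] by (simp add: row_logderiv_0)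
  ultimately show ?thesis by (simp add: word_weight_def row_logderiv_0)
qed

text \<open>Only \<open>w = 10\<close> with \<open>i = j\<close> survives, because the other
  polynomials in the recursion have no constant term.\<close>

lemma coeff_X10_Suc: "coeff_X10 (Suc j) = (- 1) ^ j * (1 / 2) ^ Suc j / real (Suc j)"
proof -
  have ten: "[True, False] \<in> short_words (i + 2)" for i
    by (simp add: short_words_def W_def)
  have "coeff_X10 (Suc j) = (\<Sum>i\<le>j. \<Sum>w\<in>short_words (i + 2).
      if w = [True, False] then fps_nth (word_weight w) i / real (Suc j) * of_bool (j - i = 0) else 0)"
    unfolding coeff_X10_def theta_poly_eq word_poly_theta.simps lookup_sum lookup_variable_mult
      lookup_word_poly_theta_0 ..
  also have "\<dots> = (\<Sum>i\<le>j. fps_nth (row_logderiv 2) i / real (Suc j) * of_bool (j - i = 0))"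
    using ten by (simp add: word_weight_10)
  also have "\<dots> = (\<Sum>i\<le>j. if i = j then fps_nth (row_logderiv 2) i / real (Suc j) else 0)"
    by (intro sum.cong) auto
  also have "\<dots> = fps_nth (row_logderiv 2) j / real (Suc j)" by simp
  finally show ?thesis by (simp only: fps_nth_row_logderiv_2)
qed

lemma coeff_X10_0: "coeff_X10 0 = 0"
  using single_one_add_neq_zero[of "[True, False]" 0]
  by (simp add: coeff_X10_def theta_poly_eq lookup_one when_def)

theorem corollary2p4:
  shows "(\<forall>j. coeff_X10 j = fps_nth log_series j) \<and> coeff_X10 sums ln (3 / 2)"
proof
  show "\<forall>j. coeff_X10 j = fps_nth log_series j"
  proof
    fix j
    show "coeff_X10 j = fps_nth log_series j"
      unfolding log_series_def fps_nth_compose_linear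
      by (cases j) (simp_all add: coeff_X10_0 coeff_X10_Suc fps_ln_nth)
  qed
  define c where "c = (\<lambda>j. (- 1) ^ j * (1 / 2 :: real) ^ Suc j / real (Suc j))"
  \<comment> \<open>\<open>ln_series\<close> only evaluates \<open>suminf\<close>, so convergence is
    shown separately by a geometric majorant.\<close>
  have "summable (\<lambda>j. (1 / 2 :: real) ^ Suc j)"
    by (simp add: summable_geometric)
  moreover have "norm (c j) \<le> (1 / 2) ^ Suc j" for j
  proof -
    have "norm (c j) = (1 / 2) ^ Suc j / real (Suc j)"
      by (simp add: c_def abs_mult power_abs)
    also have "\<dots> \<le> (1 / 2) ^ Suc j / 1"
      by (rule divide_left_mono) simp_all
    finally show ?thesis by simp
  qed
  ultimately have "summable c"
    by (rule summable_comparison_test')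
  moreover have "ln (3 / 2) = suminf c"
    using ln_series[of "3 / 2"] by (simp add: c_def field_simps)
  ultimately have "(\<lambda>j. coeff_X10 (Suc j)) sums ln (3 / 2)"
    by (simp add: coeff_X10_Suc c_def summable_sums)
  then show "coeff_X10 sums ln (3 / 2)"
    by (simp add: sums_Suc_iff coeff_X10_0)
qed

end
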